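(* Let $\{(z_n,x_n,y_n,\tau_n): n\ge 1\}$ be the sequence generated by the algorithm GRPDA-L (defined in the context). For $N\ge 1$ define $$S_N=\sum_{n=1}^N\tau_n,\qquad X_N=\frac1{S_N}\sum_{n=1}^N\tau_n x_n,\qquad Y_N=\frac1{S_N}\sum_{n=1}^N\tau_n y_n.$$ Then there exists a constant $\underline{c}>0$, with $\sum_{n=1}^N\tau_n\ge\underline{c}N$ for all $N\ge1$, such that for every $(\bar x,\bar y)\in\Omega$ and every $N\ge 1$, $$G(X_N,Y_N)\le\frac{1}{2\underline{c}N}\Big(\frac{\psi}{\psi-1}\|z_2-\bar x\|^2+\frac1\beta\|y_0-\bar y\|^2\Big),$$ where $G$ is the primal-dual gap function associated with $(\bar x,\bar y)$.
   Context: Setting. $\mathbb{R}^p,\mathbb{R}^q$ are finite-dimensional Euclidean spaces with inner product $\langle\cdot,\cdot\rangle$ and induced norm $\|\cdot\|$; $f:\mathbb{R}^p\to(-\infty,+\infty]$ and $g:\mathbb{R}^q\to(-\infty,+\infty]$ are closed proper convex functions; $K\in\mathbb{R}^{p\times q}$ is a linear map from $\mathbb{R}^q$ to $\mathbb{R}^p$ with adjoint $K^\top$; $f^*(y)=\sup_{x}\{\langle y,x\rangle-f(x)\}$ is the Legendre-Fenchel conjugate. Put $\mathcal{L}(x,y)=g(x)+\langle Kx,y\rangle-f^*(y)$. Standing assumption: the set of minimizers of $\min_{x\in\mathbb{R}^q} g(x)+f(Kx)$ is nonempty, and there is $\tilde x\in \mathrm{ri}(\mathrm{dom}(g))$ with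 $K\tilde x\in \mathrm{ri}(\mathrm{dom}(f))$ (ri denotes relative interior, dom the effective domain). The solution set of the saddle point problem $\min_x\max_y\mathcal{L}(x,y)$ is $\Omega=\{(\bar x,\bar y)\in\mathbb{R}^q\times\mathbb{R}^p: 0\in\partial g(\bar x)+K^\top\bar y,\ 0\in\partial f^*(\bar y)-K\bar x\}$. For $(\bar x,\bar y)\in\Omega$, the primal-dual gap function is $G(x,y)=\mathcal{L}(x,\bar y)-\mathcal{L}(\bar x,y)=P(x)+D(y)\ge0$, where $P(x)=g(x)-g(\bar x)+\langle K^\top\bar y,x-\bar x\rangle$ and $D(y)=f^*(y)-f^*(\bar y)-\langle K\bar x,y-\bar y\rangle$. For $\lambda>0$ and closed proper convex $h$, $\mathrm{Prox}_{\lambda h}(x)=\arg\min_y\{h(y)+\frac{1}{2\lambda}\|y-x\|^2\}$. Let $\phi=\frac{\sqrt5+1}{2}$. Algorithm GRPDA-L. Choose $x_0=z_0\in\mathbb{R}^q$, $y_0\in\mathbb{R}^p$, $\psi\in(1,\phi)$, $\sigma\in(0,1)$, $\beta>0$, $\mu\in(0,1)$, $\tau_0>0$; set $\varphi=\frac{1+\psi}{\psi^2}\in(1,2)$. For $n=1,2,\ldots$: (1) $z_n=\frac{\psi-1}{\psi}x_{n-1}+\frac1\psi z_{n-1}$ and $x_n=\mathrm{Prox}_{\tau_{n-1}g}(z_n-\tau_{n-1}K^\top y_{n-1})$; (2) (linesearch) $y_n=\mathrm{Prox}_{\beta\tau_n f^*}(y_{n-1}+\beta\tau_n Kx_n)$,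 where $\tau_n=\varphi\tau_{n-1}\mu^i$ and $i$ is the smallest nonnegative integer such that, with this $\tau_n$ and the corresponding $y_n$, $\sqrt{\beta\tau_n}\,\|K^\top y_n-K^\top y_{n-1}\|\le\sigma\sqrt{\psi/\tau_{n-1}}\,\|y_n-y_{n-1}\|$. (Such an $i$ always exists.) *)

theory Defs
  imports "HOL-Analysis.Analysis"
begin

text \<open>The library's \<open>epigraph\<close> and \<open>convex_on\<close> are for real-valued functions only.\<close>

definition ereal_epigraph :: "('a \<Rightarrow> ereal) \<Rightarrow> ('a \<times> real) set" where
  "ereal_epigraph h = {(x, t). h x \<le> ereal t}"

definition edom :: "('a \<Rightarrow> ereal) \<Rightarrow> 'a set" where
  "edom h = {x. h x < \<infinity>}"

definition closed_proper_convex :: "('a::euclidean_space \<Rightarrow> ereal) \<Rightarrow> bool" where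
  "closed_proper_convex h \<longleftrightarrow>
     (\<forall>x. h x \<noteq> -\<infinity>) \<and> edom h \<noteq> {} \<and>
     convex (ereal_epigraph h) \<and> closed (ereal_epigraph h)"

definition conjugate :: "('a::euclidean_space \<Rightarrow> ereal) \<Rightarrow> 'a \<Rightarrow> ereal" where
  "conjugate h y = (SUP x. ereal (y \<bullet> x) - h x)"

text \<open>For proper \<open>h\<close> this set is empty at points outside \<open>edom h\<close>.\<close>

definition subdifferential :: "('a::euclidean_space \<Rightarrow> ereal) \<Rightarrow> 'a \<Rightarrow> 'a set" where
  "subdifferential h x = {v. \<forall>y. h x + ereal (v \<bullet> (y - x)) \<le> h y}"

text \<open>\<open>prox l h\<close> is the proximal mapping of \<open>l h\<close>, for \<open>l > 0\<close>. The minimizer exists and is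
  unique when \<open>h\<close> is closed, proper and convex.\<close>

definition prox :: "real \<Rightarrow> ('a::euclidean_space \<Rightarrow> ereal) \<Rightarrow> 'a \<Rightarrow> 'a" where
  "prox l h x = (ARG_MIN (\<lambda>y. h y + ereal (1 / (2 * l) * (norm (y - x))\<^sup>2)) y. True)"

definition lagrangian ::
  "('p::euclidean_space \<Rightarrow> ereal) \<Rightarrow> ('q::euclidean_space \<Rightarrow> ereal) \<Rightarrow> ('q \<Rightarrow> 'p) \<Rightarrow> 'q \<Rightarrow> 'p \<Rightarrow> ereal" where
  "lagrangian f g K x y = g x + ereal (K x \<bullet> y) - conjugate f y"

definition saddle_solutions ::
  "('p::euclidean_space \<Rightarrow> ereal) \<Rightarrow> ('q::euclidean_space \<Rightarrow> ereal) \<Rightarrow> ('q \<Rightarrow> 'p) \<Rightarrow> ('q \<times> 'p) set" where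
  "saddle_solutions f g K =
     {(xb, yb). 0 \<in> {v + adjoint K yb | v. v \<in> subdifferential g xb} \<and>
                0 \<in> {w - K xb | w. w \<in> subdifferential (conjugate f) yb}}"

text \<open>For \<open>(xb, yb)\<close> in \<open>saddle_solutions f g K\<close> both \<open>g xb\<close> and \<open>conjugate f yb\<close> are finite, so
  the gap below never involves a difference of infinities of the same sign.\<close>

definition pd_gap ::
  "('p::euclidean_space \<Rightarrow> ereal) \<Rightarrow> ('q::euclidean_space \<Rightarrow> ereal) \<Rightarrow> ('q \<Rightarrow> 'p) \<Rightarrow> 'q \<Rightarrow> 'p
     \<Rightarrow> 'q \<Rightarrow> 'p \<Rightarrow> ereal" where
  "pd_gap f g K xb yb x y = lagrangian f g K x yb - lagrangian f g K xb y"

text \<open>Linesearch test for a trial step \<open>t\<close>, where \<open>t0\<close> is the previous step, \<open>y0\<close> the previous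
  dual iterate and \<open>x\<close> the current primal iterate.\<close>

definition dual_step ::
  "('p::euclidean_space \<Rightarrow> ereal) \<Rightarrow> ('q::euclidean_space \<Rightarrow> 'p) \<Rightarrow> real \<Rightarrow> 'q \<Rightarrow> 'p \<Rightarrow> real \<Rightarrow> 'p" where
  "dual_step f K \<beta> x y0 t = prox (\<beta> * t) (conjugate f) (y0 + (\<beta> * t) *\<^sub>R K x)"

definition linesearch_ok ::
  "('p::euclidean_space \<Rightarrow> ereal) \<Rightarrow> ('q::euclidean_space \<Rightarrow> 'p) \<Rightarrow> real \<Rightarrow> real \<Rightarrow> real
     \<Rightarrow> real \<Rightarrow> 'q \<Rightarrow> 'p \<Rightarrow> real \<Rightarrow> bool" where
  "linesearch_ok f K \<psi> \<sigma> \<beta> t0 x y0 t \<longleftrightarrow>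
     (let y = dual_step f K \<beta> x y0 t in
       sqrt (\<beta> * t) * norm (adjoint K y - adjoint K y0) \<le> \<sigma> * sqrt (\<psi> / t0) * norm (y - y0))"

definition grpda_l ::
  "('p::euclidean_space \<Rightarrow> ereal) \<Rightarrow> ('q::euclidean_space \<Rightarrow> ereal) \<Rightarrow> ('q \<Rightarrow> 'p)
     \<Rightarrow> real \<Rightarrow> real \<Rightarrow> real \<Rightarrow> real
     \<Rightarrow> (nat \<Rightarrow> 'q) \<Rightarrow> (nat \<Rightarrow> 'q) \<Rightarrow> (nat \<Rightarrow> 'p) \<Rightarrow> (nat \<Rightarrow> real) \<Rightarrow> bool" where
  "grpda_l f g K \<psi> \<sigma> \<beta> \<mu> z x y \<tau> \<longleftrightarrow>
     x 0 = z 0 \<and> \<tau> 0 > 0 \<and>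
     (\<forall>n\<ge>1.
        z n = ((\<psi> - 1) / \<psi>) *\<^sub>R x (n - 1) + (1 / \<psi>) *\<^sub>R z (n - 1) \<and>
        x n = prox (\<tau> (n - 1)) g (z n - \<tau> (n - 1) *\<^sub>R adjoint K (y (n - 1))) \<and>
        (let trial = (\<lambda>i. (1 + \<psi>) / \<psi>\<^sup>2 * \<tau> (n - 1) * \<mu> ^ i);
             ok = (\<lambda>i. linesearch_ok f K \<psi> \<sigma> \<beta> (\<tau> (n - 1)) (x n) (y (n - 1)) (trial i))
         in \<exists>i. ok i \<and> (\<forall>j<i. \<not> ok j) \<and> \<tau> n = trial i) \<and>
        y n = dual_step f K \<beta> (x n) (y (n - 1)) (\<tau> n))"

definition ergodic_mean :: "(nat \<Rightarrow> real) \<Rightarrow> (nat \<Rightarrow> 'a::real_vector) \<Rightarrow> nat \<Rightarrow> 'a" where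
  "ergodic_mean \<tau> u N = (1 / (\<Sum>n=1..N. \<tau> n)) *\<^sub>R (\<Sum>n=1..N. \<tau> n *\<^sub>R u n)"

end

theory Submission
  imports Defs
begin

text \<open>Three prox inequalities are added: the one for \<open>x (n + 1)\<close> tested at \<open>xb\<close>, the one for \<open>x n\<close>
  tested at \<open>x (n + 1)\<close> and rescaled by \<open>\<tau> n / \<tau> (n - 1)\<close>, and the one for \<open>y n\<close> tested at \<open>yb\<close>. The
  bilinear terms combine to the gap at \<open>(x n, y n)\<close> and a coupling term that the linesearch test and
  Young's inequality absorb; \<open>\<tau> n \<le> (1 + \<psi>) / \<psi>\<^sup>2 * \<tau> (n - 1)\<close> makes the remaining coefficient of
  \<open>(norm (x (n + 1) - z (n + 1)))\<^sup>2\<close> nonpositive. The estimate telescopes, and Jensen's inequality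
  passes to the ergodic means. No lower bound on the individual step sizes is used, only
  one on their averages.\<close>

section \<open>Closed proper convex functions, affine minorants and conjugates\<close>

lemma edom_real:
  assumes "closed_proper_convex h" "x \<in> edom h"
  shows "h x = ereal (real_of_ereal (h x))"
  using assms unfolding closed_proper_convex_def edom_def by (cases "h x") auto

text \<open>Finite values put the graph points over \<open>a\<close> and \<open>b\<close> in the
  epigraph; its convexity yields both a convex domain and the inequality. This makes the real-valued
  Jensen inequality available.\<close>

lemma closed_proper_convex_convex_on:
  assumes "closed_proper_convex h"
  shows "convex_on (edom h) (\<lambda>x. real_of_ereal (h x))"
proof -
  have cv: "convex (ereal_epigraph h)"
    using assms by (auto simp: closed_proper_convex_def)
  have *: "h (u *\<^sub>R a + v *\<^sub>R b) \<le> ereal (u * real_of_ereal (h a) + v * real_of_ereal (h b))"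
    if "a \<in> edom h" "b \<in> edom h" "u \<ge> 0" "v \<ge> 0" "u + v = 1" for a b u v
  proof -
    have "(a, real_of_ereal (h a)) \<in> ereal_epigraph h" "(b, real_of_ereal (h b)) \<in> ereal_epigraph h"
      using edom_real[OF assms that(1)] edom_real[OF assms that(2)] by (auto simp: ereal_epigraph_def)
    then have "u *\<^sub>R (a, real_of_ereal (h a)) + v *\<^sub>R (b, real_of_ereal (h b)) \<in> ereal_epigraph h"
      using cv that unfolding convex_def by blast
    then show ?thesis by (simp add: ereal_epigraph_def)
  qed
  have dom: "u *\<^sub>R a + v *\<^sub>R b \<in> edom h"
    if "a \<in> edom h" "b \<in> edom h" "u \<ge> 0" "v \<ge> 0" "u + v = 1" for a b u v
    using *[OF that] by (auto simp: edom_def)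
  show ?thesis
    unfolding convex_on_def
  proof (intro conjI ballI allI impI)
    show "convex (edom h)" using dom by (auto simp: convex_def)
  next
    fix a b u v assume A: "a \<in> edom h" "b \<in> edom h" "(u::real) \<ge> 0" "v \<ge> 0" "u + v = 1"
    show "real_of_ereal (h (u *\<^sub>R a + v *\<^sub>R b)) \<le> u * real_of_ereal (h a) + v * real_of_ereal (h b)"
      using *[OF A] edom_real[OF assms dom[OF A]] by (metis ereal_less_eq(3))
  qed
qed

text \<open>A point just below the graph is strictly separated from the closed convex epigraph;
  solving the separating hyperplane for its last coordinate gives the minorant.\<close>

lemma closed_proper_convex_affine_minorant:
  assumes "closed_proper_convex h"
  obtains v c where "\<And>x. ereal (v \<bullet> x + c) \<le> h x"
proof -
  have E: "convex (ereal_epigraph h)" "closed (ereal_epigraph h)"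
    using assms by (auto simp: closed_proper_convex_def)
  obtain x0 where x0: "x0 \<in> edom h" using assms by (auto simp: closed_proper_convex_def)
  define r where "r = real_of_ereal (h x0)"
  have r: "h x0 = ereal r" unfolding r_def by (rule edom_real[OF assms x0])
  have "(x0, r - 1) \<notin> ereal_epigraph h" by (simp add: ereal_epigraph_def r)
  then obtain a b where ab: "a \<bullet> (x0, r - 1) < b" "\<And>w. w \<in> ereal_epigraph h \<Longrightarrow> a \<bullet> w > b"
    using separating_hyperplane_closed_point[OF E] by blast
  obtain v s where a: "a = (v, s)" by (cases a)
  have "(x0, r) \<in> ereal_epigraph h" by (simp add: ereal_epigraph_def r)
  \<comment> \<open>The separated points \<open>(x0, r - 1)\<close> and \<open>(x0, r)\<close>
    differ only in height, so the hyperplane cannot be vertical.\<close>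
  from ab(2)[OF this] ab(1) have s: "s > 0" by (simp add: a algebra_simps)
  have "ereal ((- (1/s) *\<^sub>R v) \<bullet> x + b / s) \<le> h x" for x
  proof (cases "x \<in> edom h")
    case True
    have "(x, real_of_ereal (h x)) \<in> ereal_epigraph h"
      using edom_real[OF assms True] by (simp add: ereal_epigraph_def)
    from ab(2)[OF this] have "b < v \<bullet> x + s * real_of_ereal (h x)" by (simp add: a)
    then have "(- (1/s) *\<^sub>R v) \<bullet> x + b / s \<le> real_of_ereal (h x)"
      using s by (simp add: field_simps)
    then show ?thesis using edom_real[OF assms True] by (metis ereal_less_eq(3))
  next
    case False then show ?thesis by (simp add: edom_def)
  qed
  then show ?thesis by (rule that)
qed

text \<open>Points outside \<open>edom h\<close> contribute \<open>-\<infinity>\<close> to the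
  supremum, so only real inequalities remain.\<close>

lemma conjugate_le_iff:
  assumes "\<And>x. h x \<noteq> -\<infinity>"
  shows "conjugate h y \<le> ereal t \<longleftrightarrow> (\<forall>x\<in>edom h. y \<bullet> x - real_of_ereal (h x) \<le> t)"
proof -
  have "ereal (y \<bullet> x) - h x \<le> ereal t \<longleftrightarrow> (x \<in> edom h \<longrightarrow> y \<bullet> x - real_of_ereal (h x) \<le> t)" for x
    using assms[of x] by (cases "h x") (auto simp: edom_def)
  then show ?thesis unfolding conjugate_def SUP_le_iff by auto
qed

text \<open>The epigraph of the conjugate is an intersection of closed half-spaces, one for each
  point of \<open>edom h\<close>. The slope of an affine minorant of \<open>h\<close> is a point
  where the conjugate is finite, and any point of \<open>edom h\<close> keeps it above
  \<open>-\<infinity>\<close>.\<close>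

lemma closed_proper_convex_conjugate:
  assumes "closed_proper_convex h"
  shows "closed_proper_convex (conjugate h)"
proof -
  have nm: "h x \<noteq> -\<infinity>" for x
    using assms by (auto simp: closed_proper_convex_def)
  obtain x0 where x0: "x0 \<in> edom h" using assms by (auto simp: closed_proper_convex_def)
  have epi: "ereal_epigraph (conjugate h) = (\<Inter>x\<in>edom h. {w. (x, -1) \<bullet> w \<le> real_of_ereal (h x)})"
    by (auto simp: ereal_epigraph_def conjugate_le_iff[OF nm] inner_commute algebra_simps)
  obtain v c where vc: "\<And>x. ereal (v \<bullet> x + c) \<le> h x"
    using closed_proper_convex_affine_minorant[OF assms] by blast
  have "v \<bullet> x - real_of_ereal (h x) \<le> - c" if "x \<in> edom h" for x
    using vc[of x] edom_real[OF assms that] by (cases "h x") auto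
  then have "conjugate h v \<le> ereal (- c)" by (simp add: conjugate_le_iff[OF nm])
  then have "v \<in> edom (conjugate h)" by (cases "conjugate h v") (auto simp: edom_def)
  then have "edom (conjugate h) \<noteq> {}" by blast
  moreover have "conjugate h y \<noteq> -\<infinity>" for y
  proof -
    have "ereal (y \<bullet> x0) - h x0 \<le> conjugate h y"
      unfolding conjugate_def by (rule SUP_upper) simp
    then show ?thesis using edom_real[OF assms x0] by (cases "h x0") auto
  qed
  moreover have "convex (ereal_epigraph (conjugate h))" "closed (ereal_epigraph (conjugate h))"
    unfolding epi by (intro convex_INT closed_INT ballI convex_halfspace_le closed_halfspace_le)+
  ultimately show ?thesis by (simp add: closed_proper_convex_def)
qed

section \<open>The proximal mapping\<close>

text \<open>Minimizing over the epigraph replaces \<open>h\<close> by the continuous objective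
  \<open>\<Phi>\<close> on a closed set. Quadratic growth beats the affine minorant, so a sublevel
  set lies in a compact box.\<close>

lemma prox_objective_has_minimizer:
  assumes "closed_proper_convex h" "l > 0"
  shows "\<exists>p. is_arg_min (\<lambda>y. h y + ereal (1 / (2 * l) * (norm (y - x))\<^sup>2)) (\<lambda>y. True) p"
proof -
  define k where "k = 1 / (2 * l)"
  have k: "k > 0" using assms by (simp add: k_def)
  define \<Phi> where "\<Phi> w = snd w + k * (norm (fst w - x))\<^sup>2" for w :: "'a \<times> real"
  obtain x0 where x0: "x0 \<in> edom h" using assms by (auto simp: closed_proper_convex_def)
  define w0 where "w0 = (x0, real_of_ereal (h x0))"
  have w0: "w0 \<in> ereal_epigraph h"
    using edom_real[OF assms(1) x0] by (simp add: ereal_epigraph_def w0_def)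
  obtain v c where vc: "\<And>x. ereal (v \<bullet> x + c) \<le> h x"
    using closed_proper_convex_affine_minorant[OF assms(1)] by blast
  define A where "A = \<bar>\<Phi> w0 - c - v \<bullet> x\<bar>"
  \<comment> \<open>For \<open>d > 1\<close> the bound \<open>kd\<close> below can be divided by
    \<open>d\<close>, giving \<open>d \<le> (norm v + A) / k\<close>; the summand 1 covers
    \<open>d \<le> 1\<close>.\<close>
  define R where "R = 1 + (norm v + A) / k"
  define B where "B = cball x R \<times> {v \<bullet> x + c - norm v * R .. \<Phi> w0}"
  have inB: "w \<in> B" if w: "w \<in> ereal_epigraph h" and le: "\<Phi> w \<le> \<Phi> w0" for w
  proof -
    obtain u t where ut: "w = (u, t)" by (cases w)
    define d where "d = norm (u - x)"
    have "ereal (v \<bullet> u + c) \<le> ereal t"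
      using vc[of u] w by (auto simp: ut ereal_epigraph_def simp del: ereal_less_eq intro: order_trans)
    then have t: "v \<bullet> u + c \<le> t" by simp
    have "\<bar>v \<bullet> (u - x)\<bar> \<le> norm v * d" unfolding d_def by (rule Cauchy_Schwarz_ineq2)
    then have vu: "v \<bullet> u \<ge> v \<bullet> x - norm v * d" by (simp add: inner_diff_right)
    have td: "t + k * d\<^sup>2 \<le> \<Phi> w0" using le by (simp add: \<Phi>_def ut d_def)
    have kd: "k * d\<^sup>2 \<le> A + norm v * d" using td t vu by (simp add: A_def)
    have "d \<ge> 0" "A \<ge> 0" by (simp_all add: d_def A_def)
    have dR: "d \<le> R"
    proof (cases "d \<le> 1")
      case True
      have "(norm v + A) / k \<ge> 0" using k \<open>A \<ge> 0\<close> by simp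
      then show ?thesis using True by (simp add: R_def)
    next
      case False
      then have "A \<le> A * d" using \<open>A \<ge> 0\<close> by (simp add: mult_le_cancel_left1)
      then have "d * (k * d) \<le> d * (norm v + A)" using kd by (simp add: power2_eq_square algebra_simps)
      then have "k * d \<le> norm v + A" using False by simp
      then have "d \<le> (norm v + A) / k" using k by (simp add: field_simps)
      then show ?thesis by (simp add: R_def)
    qed
    have "norm v * d \<le> norm v * R" using dR by (simp add: mult_left_mono)
    moreover have "k * d\<^sup>2 \<ge> 0" using k by simp
    ultimately have "v \<bullet> x + c - norm v * R \<le> t" "t \<le> \<Phi> w0"
      using t vu td by linarith+
    then show ?thesis using dR by (simp add: B_def ut dist_norm d_def norm_minus_commute)
  qed
  have "closed (ereal_epigraph h)" using assms by (auto simp: closed_proper_convex_def)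
  then have "compact (B \<inter> ereal_epigraph h)"
    unfolding B_def by (intro compact_Int_closed compact_Times) auto
  moreover have "B \<inter> ereal_epigraph h \<noteq> {}" using inB[OF w0] w0 by auto
  moreover have "continuous_on (B \<inter> ereal_epigraph h) \<Phi>"
    unfolding \<Phi>_def by (intro continuous_intros)
  ultimately obtain w where w: "w \<in> B \<inter> ereal_epigraph h" "\<And>w'. w' \<in> B \<inter> ereal_epigraph h \<Longrightarrow> \<Phi> w \<le> \<Phi> w'"
    by (metis continuous_attains_inf)
  \<comment> \<open>Epigraph points outside \<open>B\<close> have objective above
    \<open>\<Phi> w0\<close>, and \<open>w0\<close> itself lies in \<open>B\<close>.\<close>
  have min: "\<Phi> w \<le> \<Phi> w'" if "w' \<in> ereal_epigraph h" for w'
    using w(2)[of w'] w(2)[of w0] inB[OF that] inB[OF w0] w0 that by force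
  have "h (fst w) + ereal (k * (norm (fst w - x))\<^sup>2) \<le> h u + ereal (k * (norm (u - x))\<^sup>2)" for u
  proof (cases "u \<in> edom h")
    case True
    have "(u, real_of_ereal (h u)) \<in> ereal_epigraph h"
      using edom_real[OF assms(1) True] by (simp add: ereal_epigraph_def)
    from min[OF this] have "ereal (snd w) + ereal (k * (norm (fst w - x))\<^sup>2)
        \<le> ereal (real_of_ereal (h u)) + ereal (k * (norm (u - x))\<^sup>2)" by (simp add: \<Phi>_def)
    moreover have "h (fst w) \<le> ereal (snd w)" using w(1) by (auto simp: ereal_epigraph_def)
    ultimately show ?thesis
      using edom_real[OF assms(1) True] by (metis add_right_mono order_trans)
  next
    case False then show ?thesis by (simp add: edom_def)
  qed
  then show ?thesis unfolding k_def is_arg_min_linorder by auto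
qed

text \<open>First-order optimality, saying that \<open>(x - p) / l\<close> is a subgradient of
  \<open>h\<close> at the proximal point \<open>p\<close>: compare \<open>p\<close> with points on
  the segment towards \<open>u\<close>, divide by the segment parameter and let it tend to
  0.\<close>

lemma prox_variational:
  assumes "closed_proper_convex h" "l > 0"
  shows prox_in_edom: "prox l h x \<in> edom h"
    and prox_variational_inequality: "\<And>u. u \<in> edom h \<Longrightarrow>
      real_of_ereal (h (prox l h x)) + (1 / l) * ((x - prox l h x) \<bullet> (u - prox l h x))
        \<le> real_of_ereal (h u)"
proof -
  define p where "p = prox l h x"
  have "is_arg_min (\<lambda>y. h y + ereal (1 / (2 * l) * (norm (y - x))\<^sup>2)) (\<lambda>y. True) p"
    unfolding p_def prox_def arg_min_def using prox_objective_has_minimizer[OF assms] by (rule someI_ex)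
  then have min: "h p + ereal (1 / (2 * l) * (norm (p - x))\<^sup>2) \<le> h u + ereal (1 / (2 * l) * (norm (u - x))\<^sup>2)" for u
    by (simp add: is_arg_min_linorder)
  obtain x0 where x0: "x0 \<in> edom h" using assms by (auto simp: closed_proper_convex_def)
  show pd: "prox l h x \<in> edom h"
    using min[of x0] x0 by (cases "h p") (auto simp: edom_def p_def[symmetric])
  then have pd: "p \<in> edom h" by (simp add: p_def)
  define H where "H u = real_of_ereal (h u)" for u
  have minr: "H p + 1 / (2 * l) * (norm (p - x))\<^sup>2 \<le> H u + 1 / (2 * l) * (norm (u - x))\<^sup>2"
    if "u \<in> edom h" for u
    using min[of u] edom_real[OF assms(1) pd] edom_real[OF assms(1) that]
    unfolding H_def by (metis ereal_less_eq(3) plus_ereal.simps(1))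
  have cvx: "convex_on (edom h) H"
    unfolding H_def by (rule closed_proper_convex_convex_on[OF assms(1)])
  fix u assume u: "u \<in> edom h"
  \<comment> \<open>Convexity bounds \<open>H\<close> on the segment linearly in \<open>s\<close>,
    while the squared distance contributes a second-order term; division by \<open>s\<close> leaves
    an error linear in \<open>s\<close>.\<close>
  have key: "H p + (1 / l) * ((x - p) \<bullet> (u - p)) - H u \<le> s * ((norm (u - p))\<^sup>2 / (2 * l))"
    if s: "0 < s" "s < 1" for s
  proof -
    have eq: "(1 - s) *\<^sub>R p + s *\<^sub>R u = p + s *\<^sub>R (u - p)" by (simp add: algebra_simps)
    have mem: "(1 - s) *\<^sub>R p + s *\<^sub>R u \<in> edom h"
      using convex_on_imp_convex[OF cvx] s pd u by (simp add: convexD)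
    have "H ((1 - s) *\<^sub>R p + s *\<^sub>R u) \<le> (1 - s) * H p + s * H u"
      using convex_onD[OF cvx, of s p u] s pd u by simp
    with minr[OF mem] have 1: "1 / (2 * l) * (norm (p - x))\<^sup>2
        \<le> s * (H u - H p) + 1 / (2 * l) * (norm (p + s *\<^sub>R (u - p) - x))\<^sup>2"
      unfolding eq by (simp add: algebra_simps)
    have 2: "(norm (p + s *\<^sub>R (u - p) - x))\<^sup>2
        = (norm (p - x))\<^sup>2 - 2 * s * ((x - p) \<bullet> (u - p)) + s\<^sup>2 * (norm (u - p))\<^sup>2"
      unfolding power2_norm_eq_inner by (simp add: inner_simps inner_commute power2_eq_square algebra_simps)
    have "1 / (2 * l) * (norm (p - x))\<^sup>2 \<le> 1 / (2 * l) * (norm (p - x))\<^sup>2 +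
      s * (H u - H p - (1 / l) * ((x - p) \<bullet> (u - p)) + s * ((norm (u - p))\<^sup>2 / (2 * l)))"
      using 1 unfolding 2 using assms(2) by (simp add: field_simps power2_eq_square)
    then have "0 \<le> H u - H p - (1 / l) * ((x - p) \<bullet> (u - p)) + s * ((norm (u - p))\<^sup>2 / (2 * l))"
      using s by (simp add: zero_le_mult_iff)
    then show ?thesis by linarith
  qed
  have "((\<lambda>s. s * ((norm (u - p))\<^sup>2 / (2 * l))) \<longlongrightarrow> 0 * ((norm (u - p))\<^sup>2 / (2 * l))) (at_right 0)"
    by (intro tendsto_intros)
  moreover have "\<forall>\<^sub>F s in at_right 0. H p + (1 / l) * ((x - p) \<bullet> (u - p)) - H u
      \<le> s * ((norm (u - p))\<^sup>2 / (2 * l))"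
    using eventually_at_right_less eventually_at_right_field[of "\<lambda>s. s < 1" 0]
    by (metis (mono_tags, lifting) key eventually_at_right_field zero_less_one)
  ultimately have "H p + (1 / l) * ((x - p) \<bullet> (u - p)) - H u \<le> 0"
    using tendsto_lowerbound[of _ 0 "at_right (0::real)"] by force
  then show "real_of_ereal (h (prox l h x)) + (1 / l) * ((x - prox l h x) \<bullet> (u - prox l h x))
        \<le> real_of_ereal (h u)"
    by (simp add: H_def p_def)
qed

section \<open>Linear growth of the sum of the step sizes\<close>

text \<open>A step that fails to grow satisfies \<open>\<tau> (Suc n) * \<tau> n \<ge> P\<close>, so a single step size may be
  arbitrarily small, but only after a correspondingly large one. The potential
  \<open>- \<bar>ln \<tau> - ln P / 2\<bar>\<close> pays for the logarithmically many steps needed to recover.\<close>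

lemma stepsize_sum_linear:
  fixes \<tau> :: "nat \<Rightarrow> real"
  assumes pos: "\<And>n. \<tau> n > 0" and "\<phi> > 1" "P > 0"
    and step: "\<And>n. \<tau> (Suc n) = \<phi> * \<tau> n \<or> \<tau> (Suc n) * \<tau> n \<ge> P"
  shows "\<exists>c>0. \<forall>N\<ge>1. (\<Sum>n=1..N. \<tau> n) \<ge> c * real N"
proof -
  define m where "m = ln P / 2"
  define b where "b n = ln (\<tau> n) - m" for n
  define d where "d = exp m * min 1 (ln \<phi>)"
  define V where "V n = exp m * \<bar>b n\<bar>" for n
  have \<tau>b: "\<tau> n = exp m * exp (b n)" for n
    using pos[of n] by (simp add: b_def flip: exp_add)
  have d: "d > 0" using assms by (simp add: d_def)
  have dle: "d \<le> exp m" "d \<le> exp m * ln \<phi>" by (simp_all add: d_def)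
  \<comment> \<open>Amortized gain of one step, with \<open>exp m\<close> the square root of
    \<open>P\<close>. Above this level, \<open>exp b \<ge> 1 + b\<close> lets
    \<open>\<tau> (Suc n)\<close> pay for \<open>d\<close> and for \<open>V (Suc n)\<close>.
    Otherwise either growth lowers \<open>V\<close> by \<open>exp m * ln \<phi>\<close>, or the
    product bound forces \<open>\<tau> n \<ge> exp m\<close> and keeps \<open>V\<close> from
    rising.\<close>
  have one: "d \<le> \<tau> (Suc n) + \<tau> n + V n - V (Suc n)" for n
  proof (cases "b (Suc n) > 0")
    case True
    have "exp m * (1 + b (Suc n)) \<le> \<tau> (Suc n)" unfolding \<tau>b by simp
    moreover have "V n \<ge> 0" "V (Suc n) = exp m * b (Suc n)" using True by (simp_all add: V_def)
    ultimately show ?thesis using dle pos[of n] by (simp add: algebra_simps)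
  next
    case False
    from step[of n] show ?thesis
    proof
      assume "\<tau> (Suc n) = \<phi> * \<tau> n"
      then have "b (Suc n) = b n + ln \<phi>" using pos[of n] \<open>\<phi> > 1\<close> by (simp add: b_def ln_mult less_imp_neq[symmetric])
      moreover have "ln \<phi> > 0" using assms by simp
      ultimately have "\<bar>b n\<bar> = \<bar>b (Suc n)\<bar> + ln \<phi>" using False by auto
      then have "V n - V (Suc n) = exp m * ln \<phi>" by (simp add: V_def algebra_simps)
      then show ?thesis using dle pos[of n] pos[of "Suc n"] by linarith
    next
      assume "\<tau> (Suc n) * \<tau> n \<ge> P"
      then have "ln P \<le> ln (\<tau> (Suc n) * \<tau> n)" using assms by simp
      then have bb: "b (Suc n) + b n \<ge> 0"
        using pos[of n] pos[of "Suc n"] by (simp add: b_def m_def ln_mult)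
      then have "\<bar>b (Suc n)\<bar> \<le> \<bar>b n\<bar>" using False by simp
      then have "exp m * \<bar>b (Suc n)\<bar> \<le> exp m * \<bar>b n\<bar>" by (intro mult_left_mono) auto
      moreover have "exp m * 1 \<le> \<tau> n" unfolding \<tau>b using bb False by simp
      ultimately show ?thesis using dle pos[of "Suc n"] unfolding V_def by linarith
    qed
  qed
  define C where "C = \<tau> 0 + V 0"
  have C: "C \<ge> 0" using pos[of 0] by (simp add: C_def V_def add_nonneg_nonneg less_imp_le)
  \<comment> \<open>In the sum of \<open>one\<close>, each step size appears twice except at the two
    ends; \<open>C\<close> collects the terms at index 0.\<close>
  have tot: "d * real N \<le> 2 * (\<Sum>n=1..N. \<tau> n) + C - V N - \<tau> N" for N
  proof (induction N)
    case 0 show ?case by (simp add: C_def)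
  next
    case (Suc N) then show ?case using one[of N] by (simp add: algebra_simps)
  qed
  \<comment> \<open>The sum is at least \<open>\<tau> 1\<close> once \<open>N \<ge> 1\<close>, so
    the constant \<open>C\<close> is at most \<open>C / \<tau> 1\<close> times the sum.\<close>
  define c where "c = d / (2 + C / \<tau> 1)"
  have cp: "2 + C / \<tau> 1 > 0" using C pos[of 1] by (simp add: add_pos_nonneg)
  have "c * real N \<le> (\<Sum>n=1..N. \<tau> n)" if "N \<ge> 1" for N
  proof -
    have "\<tau> 1 \<le> (\<Sum>n=1..N. \<tau> n)"
      using that pos by (intro member_le_sum) (auto intro: less_imp_le)
    then have "C \<le> (C / \<tau> 1) * (\<Sum>n=1..N. \<tau> n)"
      using C pos[of 1] by (simp add: field_simps mult_left_mono)
    moreover have "V N \<ge> 0" by (simp add: V_def)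
    ultimately have "d * real N \<le> (2 + C / \<tau> 1) * (\<Sum>n=1..N. \<tau> n)"
      using tot[of N] pos[of N] by (simp add: algebra_simps)
    then show ?thesis using cp by (simp add: c_def pos_divide_le_eq mult.commute)
  qed
  moreover have "c > 0" using d cp by (simp add: c_def)
  ultimately show ?thesis by blast
qed

section \<open>Energy decrease over one iteration\<close>

lemma polar_identity:
  fixes a b c :: "'a::real_inner"
  shows "2 * ((a - c) \<bullet> (b - c)) = (norm (a - c))\<^sup>2 + (norm (b - c))\<^sup>2 - (norm (a - b))\<^sup>2"
  unfolding power2_norm_eq_inner by (simp add: inner_simps inner_commute)

lemma norm_convex_combination:
  fixes a b :: "'a::real_inner"
  shows "(norm (s *\<^sub>R a + (1 - s) *\<^sub>R b))\<^sup>2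
    = s * (norm a)\<^sup>2 + (1 - s) * (norm b)\<^sup>2 - s * (1 - s) * (norm (a - b))\<^sup>2"
  unfolding power2_norm_eq_inner by (simp add: inner_simps inner_commute algebra_simps)

text \<open>One iteration as real algebra: at index \<open>n\<close>, \<open>x\<close>,
  \<open>z0\<close>, \<open>y\<close> carry index \<open>n\<close>, \<open>x'\<close> and
  \<open>z\<close> carry \<open>n + 1\<close>, \<open>z2\<close> carries \<open>n + 2\<close>,
  \<open>y0\<close> carries \<open>n - 1\<close>, and \<open>t0\<close>, \<open>t\<close> are the
  previous and current step sizes. \<open>gx\<close>, \<open>gx'\<close>, \<open>gb\<close>,
  \<open>fy\<close>, \<open>fb\<close> stand for function values.\<close>

lemma grpda_energy_step:
  fixes K :: "'q::euclidean_space \<Rightarrow> 'p::euclidean_space" and x x' z0 z z2 xb :: 'q and y0 y yb :: 'p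
  assumes "linear K" and \<psi>: "1 < \<psi>" and "0 < \<sigma>" "\<sigma> < 1" and \<beta>: "0 < \<beta>" and t0: "0 < t0" and t: "0 < t"
    and prox_x': "gx' + (1 / t) * ((z - t *\<^sub>R adjoint K y - x') \<bullet> (xb - x')) \<le> gb"
    and prox_x: "gx + (1 / t0) * ((z0 - t0 *\<^sub>R adjoint K y0 - x) \<bullet> (x' - x)) \<le> gx'"
    and prox_y: "fy + (1 / (\<beta> * t)) * ((y0 + (\<beta> * t) *\<^sub>R K x - y) \<bullet> (yb - y)) \<le> fb"
    and z: "z = ((\<psi> - 1) / \<psi>) *\<^sub>R x + (1 / \<psi>) *\<^sub>R z0"
    and z2: "z2 = ((\<psi> - 1) / \<psi>) *\<^sub>R x' + (1 / \<psi>) *\<^sub>R z"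
    and growth: "t \<le> (1 + \<psi>) / \<psi>\<^sup>2 * t0"
    and search: "sqrt (\<beta> * t) * norm (adjoint K y - adjoint K y0) \<le> \<sigma> * sqrt (\<psi> / t0) * norm (y - y0)"
  shows "2 * t * (gx + K x \<bullet> yb - fb - (gb + K xb \<bullet> y - fy))
      + \<psi> / (\<psi> - 1) * (norm (z2 - xb))\<^sup>2 + 1 / \<beta> * (norm (y - yb))\<^sup>2
    \<le> \<psi> / (\<psi> - 1) * (norm (z - xb))\<^sup>2 + 1 / \<beta> * (norm (y0 - yb))\<^sup>2"
proof -
  note lin = linear_diff[OF \<open>linear K\<close>]
  have adj: "adjoint K v \<bullet> u = v \<bullet> K u" for u v
    using adjoint_works[OF \<open>linear K\<close>, of u v] by (simp add: inner_commute)
  define \<delta> where "\<delta> = t / t0"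
  have \<delta>: "\<delta> > 0" using t t0 by (simp add: \<delta>_def)
  have A: "2 * t * (gx' - gb) + ((norm (z - x'))\<^sup>2 + (norm (xb - x'))\<^sup>2 - (norm (z - xb))\<^sup>2)
      - 2 * t * (y \<bullet> (K xb - K x')) \<le> 0"
  proof -
    have "t * (gx' + (1 / t) * ((z - t *\<^sub>R adjoint K y - x') \<bullet> (xb - x'))) \<le> t * gb"
      using prox_x' t by simp
    moreover have "(z - t *\<^sub>R adjoint K y - x') \<bullet> (xb - x') = (z - x') \<bullet> (xb - x') - t * (y \<bullet> (K xb - K x'))"
      by (simp add: inner_diff_left adj lin)
    ultimately have "t * gx' + (z - x') \<bullet> (xb - x') - t * (y \<bullet> (K xb - K x')) \<le> t * gb"
      using t by (simp add: distrib_left)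
    then show ?thesis unfolding polar_identity[symmetric] by (simp add: algebra_simps)
  qed
  have B: "2 * t * (gx - gx') + \<psi> * \<delta> * ((norm (z - x))\<^sup>2 + (norm (x' - x))\<^sup>2 - (norm (z - x'))\<^sup>2)
      - 2 * t * (y0 \<bullet> (K x' - K x)) \<le> 0"
  proof -
    have "t * (gx + (1 / t0) * ((z0 - t0 *\<^sub>R adjoint K y0 - x) \<bullet> (x' - x))) \<le> t * gx'"
      using prox_x t by simp
    \<comment> \<open>The averaging rule turns \<open>z0 - x\<close> into a multiple of
      \<open>z - x\<close>, so that B involves the same distance from \<open>z\<close> to
      \<open>x'\<close> as A.\<close>
    moreover have "\<psi> *\<^sub>R z = (\<psi> - 1) *\<^sub>R x + z0" using \<psi> by (simp add: z scaleR_add_right)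
    then have "z0 - t0 *\<^sub>R adjoint K y0 - x = \<psi> *\<^sub>R (z - x) - t0 *\<^sub>R adjoint K y0"
      by (simp add: algebra_simps)
    then have "(z0 - t0 *\<^sub>R adjoint K y0 - x) \<bullet> (x' - x)
        = \<psi> * ((z - x) \<bullet> (x' - x)) - t0 * (y0 \<bullet> (K x' - K x))"
      by (simp only: inner_diff_left[of _ "t0 *\<^sub>R adjoint K y0"] inner_scaleR_left adj lin)
    ultimately have "t * gx + \<psi> * \<delta> * ((z - x) \<bullet> (x' - x)) - t * (y0 \<bullet> (K x' - K x)) \<le> t * gx'"
      using t0 by (simp add: \<delta>_def distrib_left right_diff_distrib mult_ac)
    then show ?thesis unfolding polar_identity[symmetric] by (simp add: algebra_simps)
  qed
  have C: "2 * t * (fy - fb) + 1 / \<beta> * ((norm (y0 - y))\<^sup>2 + (norm (yb - y))\<^sup>2 - (norm (y0 - yb))\<^sup>2)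
      + 2 * t * (K x \<bullet> (yb - y)) \<le> 0"
  proof -
    have "t * (fy + (1 / (\<beta> * t)) * ((y0 + (\<beta> * t) *\<^sub>R K x - y) \<bullet> (yb - y))) \<le> t * fb"
      using prox_y t by simp
    moreover have "(y0 + (\<beta> * t) *\<^sub>R K x - y) \<bullet> (yb - y) = (y0 - y) \<bullet> (yb - y) + \<beta> * t * (K x \<bullet> (yb - y))"
      by (simp add: inner_diff_left inner_add_left)
    ultimately have "t * fy + 1 / \<beta> * ((y0 - y) \<bullet> (yb - y)) + t * (K x \<bullet> (yb - y)) \<le> t * fb"
      using t \<beta> by (simp add: distrib_left mult_ac)
    then have "2 * (t * fy + 1 / \<beta> * ((y0 - y) \<bullet> (yb - y)) + t * (K x \<bullet> (yb - y))) \<le> 2 * (t * fb)"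
      by simp
    then show ?thesis
      unfolding polar_identity[symmetric] right_diff_distrib by (simp only: distrib_left mult_ac)
  qed
  \<comment> \<open>Solving the averaging rule of \<open>z2\<close> for \<open>x'\<close> trades the
    distance from \<open>x'\<close> to \<open>xb\<close> for those from \<open>z2\<close> and
    \<open>z\<close>. Inserted in A, both acquire the weight \<open>\<psi> / (\<psi> - 1)\<close>,
    which is what telescopes.\<close>
  have Z: "(norm (xb - x'))\<^sup>2 = \<psi> / (\<psi> - 1) * (norm (z2 - xb))\<^sup>2 - (\<psi> / (\<psi> - 1) - 1) * (norm (z - xb))\<^sup>2
      + 1 / \<psi> * (norm (z - x'))\<^sup>2"
  proof -
    define s where "s = (\<psi> - 1) / \<psi>"
    have s: "1 - s = 1 / \<psi>" "s > 0" "\<psi> / (\<psi> - 1) = 1 / s" using \<psi> by (simp_all add: s_def field_simps)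
    have "z2 - xb = s *\<^sub>R (x' - xb) + (1 - s) *\<^sub>R (z - xb)"
      unfolding z2 s(1)[symmetric] s_def[symmetric] by (simp add: algebra_simps)
    then have "(norm (z2 - xb))\<^sup>2 = s * (norm (x' - xb))\<^sup>2 + (1 - s) * (norm (z - xb))\<^sup>2
        - s * (1 - s) * (norm (x' - z))\<^sup>2"
      by (simp add: norm_convex_combination)
    then show ?thesis
      unfolding s(1)[symmetric] s(3) norm_minus_commute[of xb x'] norm_minus_commute[of z x']
      using s(2) by (simp add: field_simps)
  qed
  \<comment> \<open>In the coefficient of the squared distance from \<open>z\<close> to
    \<open>x'\<close>, A contributes 1, Z contributes \<open>1 / \<psi>\<close>, and B subtracts
    \<open>\<psi> * \<delta>\<close>.\<close>
  have "\<psi> * \<delta> \<le> 1 + 1 / \<psi>"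
    using growth t0 \<psi> by (simp add: \<delta>_def field_simps power2_eq_square)
  then have D: "(\<psi> * \<delta> - 1 - 1 / \<psi>) * (norm (z - x'))\<^sup>2 \<le> 0"
    by (intro mult_nonpos_nonneg) auto
  have E: "2 * t * ((y - y0) \<bullet> (K x - K x')) \<le> \<psi> * \<delta> * (norm (x' - x))\<^sup>2 + 1 / \<beta> * (norm (y0 - y))\<^sup>2"
  proof -
    \<comment> \<open>\<open>r\<close> and \<open>q\<close> are the roots of the coefficients that B
      and C offer for the squared increments of \<open>x\<close> and \<open>y\<close>; the
      linesearch test, scaled by \<open>sqrt (t / \<beta>)\<close>, has exactly the factor
      \<open>r * q\<close>.\<close>
    define r where "r = sqrt (\<psi> * \<delta>)"
    define q where "q = sqrt (1 / \<beta>)"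
    have rq: "r \<ge> 0" "q \<ge> 0" "r\<^sup>2 = \<psi> * \<delta>" "q\<^sup>2 = 1 / \<beta>"
      using \<psi> \<delta> \<beta> by (simp_all add: r_def q_def)
    have "t * norm (adjoint K y - adjoint K y0)
        = sqrt (t / \<beta>) * (sqrt (\<beta> * t) * norm (adjoint K y - adjoint K y0))"
      using t \<beta> by (simp add: real_sqrt_mult[symmetric] mult.assoc[symmetric])
    also have "\<dots> \<le> sqrt (t / \<beta>) * (\<sigma> * sqrt (\<psi> / t0) * norm (y - y0))"
      using search t \<beta> by (intro mult_left_mono) auto
    also have "\<dots> = \<sigma> * (r * q * norm (y - y0))"
      by (simp add: r_def q_def \<delta>_def real_sqrt_mult real_sqrt_divide mult_ac)
    also have "\<dots> \<le> r * q * norm (y - y0)"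
      using \<open>\<sigma> < 1\<close> \<open>0 < \<sigma>\<close> rq by (intro mult_left_le_one_le) auto
    finally have F: "t * norm (adjoint K y - adjoint K y0) \<le> r * q * norm (y - y0)" .
    have "(y - y0) \<bullet> (K x - K x') = (adjoint K y - adjoint K y0) \<bullet> (x - x')"
      by (simp add: inner_diff_left adj lin)
    also have "\<dots> \<le> norm (adjoint K y - adjoint K y0) * norm (x - x')" by (rule norm_cauchy_schwarz)
    finally have "t * ((y - y0) \<bullet> (K x - K x')) \<le> t * (norm (adjoint K y - adjoint K y0) * norm (x - x'))"
      using t by simp
    also have "\<dots> \<le> (r * q * norm (y - y0)) * norm (x - x')"
      using mult_right_mono[OF F norm_ge_zero] by (simp add: mult.assoc)
    finally have "2 * t * ((y - y0) \<bullet> (K x - K x')) \<le> 2 * (r * norm (x' - x)) * (q * norm (y0 - y))"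
      by (simp add: norm_minus_commute mult_ac)
    also have "\<dots> \<le> (r * norm (x' - x))\<^sup>2 + (q * norm (y0 - y))\<^sup>2" by (rule sum_squares_bound)
    finally show ?thesis by (simp add: power_mult_distrib rq)
  qed
  have F: "\<psi> * \<delta> * (norm (z - x))\<^sup>2 \<ge> 0" using \<psi> \<delta> by simp
  \<comment> \<open>The value \<open>gx'\<close> cancels between A and B; the only bilinear
    remainder is the coupling of the two increments, bounded by E.\<close>
  have bil: "2 * t * (gx + K x \<bullet> yb - fb - (gb + K xb \<bullet> y - fy))
      = (2 * t * (gx' - gb) - 2 * t * (y \<bullet> (K xb - K x'))) + (2 * t * (gx - gx') - 2 * t * (y0 \<bullet> (K x' - K x)))
        + (2 * t * (fy - fb) + 2 * t * (K x \<bullet> (yb - y))) + 2 * t * ((y - y0) \<bullet> (K x - K x'))"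
    by (simp add: inner_simps inner_commute algebra_simps)
  show ?thesis
    unfolding bil using A[unfolded Z] B C[unfolded norm_minus_commute[of yb y]] D E F
    by (simp only: left_diff_distrib right_diff_distrib distrib_left distrib_right mult_1_left mult.assoc)
qed

section \<open>Finite gap values, ergodic averages and rejected trial steps\<close>

lemma subdifferential_imp_edom:
  assumes "closed_proper_convex h" "v \<in> subdifferential h x"
  shows "x \<in> edom h"
proof -
  obtain x0 where "x0 \<in> edom h" using assms by (auto simp: closed_proper_convex_def)
  moreover have "h x + ereal (v \<bullet> (x0 - x)) \<le> h x0" using assms by (simp add: subdifferential_def)
  ultimately show ?thesis by (cases "h x") (auto simp: edom_def)
qed

text \<open>All four function values are finite, so the extended-real gap reduces to real
  arithmetic.\<close>

lemma pd_gap_real: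
  assumes "closed_proper_convex f" "closed_proper_convex g"
    and "u \<in> edom g" "xb \<in> edom g" "v \<in> edom (conjugate f)" "yb \<in> edom (conjugate f)"
  shows "pd_gap f g K xb yb u v = ereal (real_of_ereal (g u) + K u \<bullet> yb - real_of_ereal (conjugate f yb)
    - (real_of_ereal (g xb) + K xb \<bullet> v - real_of_ereal (conjugate f v)))"
proof -
  note cf = closed_proper_convex_conjugate[OF assms(1)]
  obtain a b c d where "g u = ereal a" "g xb = ereal b" "conjugate f v = ereal c" "conjugate f yb = ereal d"
    using edom_real[OF assms(2,3)] edom_real[OF assms(2,4)] edom_real[OF cf assms(5)] edom_real[OF cf assms(6)]
    by metis
  then show ?thesis by (simp add: pd_gap_def lagrangian_def)
qed

text \<open>Jensen with weights \<open>\<tau> n / S\<close>. Membership in \<open>C\<close> is asked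
  from index 1 on because the starting points may lie outside the domains.\<close>

lemma ergodic_mean_jensen:
  assumes "convex_on C h" and u: "\<And>n. n \<ge> 1 \<Longrightarrow> u n \<in> C" and \<tau>: "\<And>n. \<tau> n > 0" and "N \<ge> 1"
  shows ergodic_mean_in_convex: "ergodic_mean \<tau> u N \<in> C"
    and ergodic_mean_convex_on_le: "(\<Sum>n=1..N. \<tau> n) * h (ergodic_mean \<tau> u N) \<le> (\<Sum>n=1..N. \<tau> n * h (u n))"
proof -
  define S where "S = (\<Sum>n=1..N. \<tau> n)"
  have S: "S > 0" unfolding S_def using \<tau> \<open>N \<ge> 1\<close> by (intro sum_pos) auto
  have mean: "ergodic_mean \<tau> u N = (\<Sum>n=1..N. (\<tau> n / S) *\<^sub>R u n)"
    by (simp add: ergodic_mean_def S_def scaleR_sum_right)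
  have w: "(\<Sum>n=1..N. \<tau> n / S) = 1" "\<And>n. \<tau> n / S \<ge> 0"
    using S \<tau> by (auto simp: S_def less_imp_le simp flip: sum_divide_distrib)
  show "ergodic_mean \<tau> u N \<in> C"
    unfolding mean using convex_on_imp_convex[OF assms(1)] w u by (intro convex_sum) auto
  have "h (ergodic_mean \<tau> u N) \<le> (\<Sum>n=1..N. \<tau> n / S * h (u n))"
    unfolding mean using assms(1,4) w u by (intro convex_on_sum) auto
  also have "\<dots> = (\<Sum>n=1..N. \<tau> n * h (u n)) / S" by (simp add: sum_divide_distrib)
  finally show "(\<Sum>n=1..N. \<tau> n) * h (ergodic_mean \<tau> u N) \<le> (\<Sum>n=1..N. \<tau> n * h (u n))"
    using S by (simp add: S_def field_simps)
qed

text \<open>The bilinear terms of the gap pass to the mean with equality; the identity map in place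
  of \<open>K\<close> serves the dual one.\<close>

lemma ergodic_mean_linear:
  assumes "linear K" "(\<Sum>n=1..N. \<tau> n) \<noteq> 0"
  shows "(\<Sum>n=1..N. \<tau> n) * (K (ergodic_mean \<tau> u N) \<bullet> v) = (\<Sum>n=1..N. \<tau> n * (K (u n) \<bullet> v))"
  using assms(2)
  by (simp add: ergodic_mean_def linear_cmul[OF assms(1)] linear_sum[OF assms(1)] inner_sum_left)

text \<open>A rejected trial violates the test although \<open>adjoint K\<close> is bounded by
  \<open>L\<close>, so the step sizes cannot both be small; squaring leaves a bound on their
  product.\<close>

lemma linesearch_fails_bound:
  fixes K :: "'q::euclidean_space \<Rightarrow> 'p::euclidean_space"
  assumes "\<not> linesearch_ok f K \<psi> \<sigma> \<beta> t0 x y0 t"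
    and L: "\<And>v. norm (adjoint K v) \<le> L * norm v" and "linear K"
    and pos: "0 < L" "0 < \<psi>" "0 < \<sigma>" "0 < \<beta>" "0 < t0" "0 < t"
  shows "\<sigma>\<^sup>2 * \<psi> / (\<beta> * L\<^sup>2) \<le> t * t0"
proof -
  define d where "d = dual_step f K \<beta> x y0 t - y0"
  have "\<sigma> * sqrt (\<psi> / t0) * norm d < sqrt (\<beta> * t) * norm (adjoint K d)"
    using assms(1) by (simp add: linesearch_ok_def Let_def d_def linear_diff[OF adjoint_linear[OF \<open>linear K\<close>]])
  also have "\<dots> \<le> sqrt (\<beta> * t) * (L * norm d)"
    using L pos by (intro mult_left_mono) auto
  finally have "(\<sigma> * sqrt (\<psi> / t0)) * norm d < (sqrt (\<beta> * t) * L) * norm d" by (simp add: mult.assoc)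
  \<comment> \<open>Strictness excludes \<open>norm d = 0\<close>, so this factor may be
    cancelled.\<close>
  then have "\<sigma> * sqrt (\<psi> / t0) \<le> sqrt (\<beta> * t) * L"
    by (simp add: mult_less_cancel_right)
  then have "(\<sigma> * sqrt (\<psi> / t0))\<^sup>2 \<le> (sqrt (\<beta> * t) * L)\<^sup>2"
    using pos by (intro power_mono) auto
  then have "\<sigma>\<^sup>2 * (\<psi> / t0) \<le> \<beta> * t * L\<^sup>2"
    using pos by (simp add: power_mult_distrib)
  then show ?thesis using pos by (simp add: field_simps)
qed

section \<open>The ergodic rate from the telescoped energy\<close>

theorem theorem3p2:
  fixes f :: "'p::euclidean_space \<Rightarrow> ereal" and g :: "'q::euclidean_space \<Rightarrow> ereal"
    and K :: "'q \<Rightarrow> 'p"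
    and \<psi> \<sigma> \<beta> \<mu> :: real
    and z x :: "nat \<Rightarrow> 'q" and y :: "nat \<Rightarrow> 'p" and \<tau> :: "nat \<Rightarrow> real"
  assumes "closed_proper_convex f" and "closed_proper_convex g" and "linear K"
    and "\<exists>xs. is_arg_min (\<lambda>u. g u + f (K u)) (\<lambda>u. True) xs"
    and "\<exists>xt. xt \<in> rel_interior (edom g) \<and> K xt \<in> rel_interior (edom f)"
    and "1 < \<psi>" and "\<psi> < (sqrt 5 + 1) / 2"
    and "0 < \<sigma>" and "\<sigma> < 1" and "0 < \<beta>" and "0 < \<mu>" and "\<mu> < 1"
    and "grpda_l f g K \<psi> \<sigma> \<beta> \<mu> z x y \<tau>"
  shows "\<exists>c>0. (\<forall>N\<ge>1. (\<Sum>n=1..N. \<tau> n) \<ge> c * real N) \<and>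
           (\<forall>xb yb. (xb, yb) \<in> saddle_solutions f g K \<longrightarrow>
             (\<forall>N\<ge>1. pd_gap f g K xb yb (ergodic_mean \<tau> x N) (ergodic_mean \<tau> y N)
                \<le> ereal (1 / (2 * c * real N) *
                    (\<psi> / (\<psi> - 1) * (norm (z 2 - xb))\<^sup>2 + 1 / \<beta> * (norm (y 0 - yb))\<^sup>2))))"
proof -
  define F where "F = conjugate f"
  define G where "G u = real_of_ereal (g u)" for u
  define H where "H v = real_of_ereal (F v)" for v
  have F: "closed_proper_convex F"
    unfolding F_def by (rule closed_proper_convex_conjugate[OF assms(1)])
  define \<phi> where "\<phi> = (1 + \<psi>) / \<psi>\<^sup>2"
  have \<phi>: "\<phi> > 1"
  proof -
    \<comment> \<open>Below the golden ratio, \<open>\<psi>\<close> satisfies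
      \<open>\<psi>\<^sup>2 < 1 + \<psi>\<close>.\<close>
    have "(2 * \<psi> - 1)\<^sup>2 < (sqrt 5)\<^sup>2" using assms(6,7) by (intro power_strict_mono) auto
    then have "\<psi>\<^sup>2 < 1 + \<psi>" by (simp add: power2_eq_square algebra_simps)
    then show ?thesis using assms(6) by (simp add: \<phi>_def)
  qed
  note alg = assms(13)[unfolded grpda_l_def Let_def, folded \<phi>_def]
  have zS: "z (Suc n) = ((\<psi> - 1) / \<psi>) *\<^sub>R x n + (1 / \<psi>) *\<^sub>R z n"
    and xS: "x (Suc n) = prox (\<tau> n) g (z (Suc n) - \<tau> n *\<^sub>R adjoint K (y n))"
    and yS: "y (Suc n) = dual_step f K \<beta> (x (Suc n)) (y n) (\<tau> (Suc n))"
    and \<tau>S: "\<exists>i. linesearch_ok f K \<psi> \<sigma> \<beta> (\<tau> n) (x (Suc n)) (y n) (\<phi> * \<tau> n * \<mu> ^ i) \<and>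
      (\<forall>j<i. \<not> linesearch_ok f K \<psi> \<sigma> \<beta> (\<tau> n) (x (Suc n)) (y n) (\<phi> * \<tau> n * \<mu> ^ j)) \<and>
      \<tau> (Suc n) = \<phi> * \<tau> n * \<mu> ^ i" for n
    using alg[THEN conjunct2, THEN conjunct2, rule_format, of "Suc n"] by auto
  have \<tau>: "\<tau> n > 0" for n
  proof (induction n)
    case 0 show ?case using alg by blast
  next
    case (Suc n) then show ?case using \<tau>S[of n] \<phi> assms(11) by auto
  qed
  have growth: "\<tau> (Suc n) \<le> \<phi> * \<tau> n" for n
  proof -
    obtain i where "\<tau> (Suc n) = \<phi> * \<tau> n * \<mu> ^ i" using \<tau>S[of n] by blast
    moreover have "\<mu> ^ i \<le> 1" using assms(11,12) by (intro power_le_one) auto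
    ultimately show ?thesis using \<phi> \<tau>[of n] by (simp add: mult_left_le)
  qed
  have search: "sqrt (\<beta> * \<tau> (Suc n)) * norm (adjoint K (y (Suc n)) - adjoint K (y n))
      \<le> \<sigma> * sqrt (\<psi> / \<tau> n) * norm (y (Suc n) - y n)" for n
    using \<tau>S[of n] yS[of n] by (auto simp: linesearch_ok_def Let_def)

  obtain L where L: "L > 0" "\<And>v. norm (adjoint K v) \<le> L * norm v"
    using linear_bounded_pos[OF adjoint_linear[OF assms(3)]] by blast
  \<comment> \<open>The accepted step is \<open>\<mu>\<close> times the last rejected trial, hence
    the factor \<open>\<mu>\<close> in front of the bound for rejected trials.\<close>
  define P where "P = \<mu> * (\<sigma>\<^sup>2 * \<psi> / (\<beta> * L\<^sup>2))"
  have P: "P > 0" using assms L by (simp add: P_def)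
  have "\<tau> (Suc n) = \<phi> * \<tau> n \<or> \<tau> (Suc n) * \<tau> n \<ge> P" for n
  proof -
    obtain i where i: "\<forall>j<i. \<not> linesearch_ok f K \<psi> \<sigma> \<beta> (\<tau> n) (x (Suc n)) (y n) (\<phi> * \<tau> n * \<mu> ^ j)"
        "\<tau> (Suc n) = \<phi> * \<tau> n * \<mu> ^ i" using \<tau>S[of n] by blast
    show ?thesis
    proof (cases i)
      case 0 then show ?thesis using i by simp
    next
      case (Suc j)
      have "\<sigma>\<^sup>2 * \<psi> / (\<beta> * L\<^sup>2) \<le> \<phi> * \<tau> n * \<mu> ^ j * \<tau> n"
        using i(1) Suc L assms \<phi> \<tau>[of n] by (intro linesearch_fails_bound[of f K]) auto
      then have "P \<le> \<mu> * (\<phi> * \<tau> n * \<mu> ^ j * \<tau> n)"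
        unfolding P_def using assms by (intro mult_left_mono) auto
      then show ?thesis using i(2) Suc by (simp add: mult_ac)
    qed
  qed
  then obtain c where c: "c > 0" "\<And>N. N \<ge> 1 \<Longrightarrow> (\<Sum>n=1..N. \<tau> n) \<ge> c * real N"
    using stepsize_sum_linear[of \<tau> \<phi> P] \<tau> \<phi> P by blast

  have xd: "x n \<in> edom g" if "n \<ge> 1" for n
    using xS[of "n - 1"] that prox_in_edom[OF assms(2) \<tau>] by simp
  have yd: "y n \<in> edom F" if "n \<ge> 1" for n
    using yS[of "n - 1"] that prox_in_edom[OF F] \<tau>[of n] assms(10) by (simp add: dual_step_def F_def)

  have "pd_gap f g K xb yb (ergodic_mean \<tau> x N) (ergodic_mean \<tau> y N)
      \<le> ereal (1 / (2 * c * real N) *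
          (\<psi> / (\<psi> - 1) * (norm (z 2 - xb))\<^sup>2 + 1 / \<beta> * (norm (y 0 - yb))\<^sup>2))"
    if sol: "(xb, yb) \<in> saddle_solutions f g K" and N: "N \<ge> 1" for xb yb N
  proof -
    have xb: "xb \<in> edom g" and yb: "yb \<in> edom F"
      using sol subdifferential_imp_edom[OF assms(2)] subdifferential_imp_edom[OF F]
      by (auto simp: saddle_solutions_def F_def)
    define gap where "gap u v = G u + K u \<bullet> yb - H yb - (G xb + K xb \<bullet> v - H v)" for u v
    \<comment> \<open>The iteration with index \<open>Suc n\<close> starts from the energy at
      \<open>z (Suc (Suc n))\<close> and \<open>y n\<close>; for \<open>n = 0\<close> this is the
      pair \<open>z 2\<close>, \<open>y 0\<close> of the final bound.\<close>
    have step: "2 * \<tau> (Suc n) * gap (x (Suc n)) (y (Suc n))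
        + \<psi> / (\<psi> - 1) * (norm (z (Suc (Suc (Suc n))) - xb))\<^sup>2 + 1 / \<beta> * (norm (y (Suc n) - yb))\<^sup>2
        \<le> \<psi> / (\<psi> - 1) * (norm (z (Suc (Suc n)) - xb))\<^sup>2 + 1 / \<beta> * (norm (y n - yb))\<^sup>2" for n
      unfolding gap_def
    proof (rule grpda_energy_step[OF assms(3,6,8,9,10) \<tau>[of n] \<tau>[of "Suc n"]])
      show "G (x (Suc (Suc n))) + 1 / \<tau> (Suc n) * ((z (Suc (Suc n)) - \<tau> (Suc n) *\<^sub>R adjoint K (y (Suc n))
          - x (Suc (Suc n))) \<bullet> (xb - x (Suc (Suc n)))) \<le> G xb"
        unfolding G_def xS[of "Suc n"] by (rule prox_variational_inequality[OF assms(2) \<tau> xb])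
      show "G (x (Suc n)) + 1 / \<tau> n * ((z (Suc n) - \<tau> n *\<^sub>R adjoint K (y n) - x (Suc n))
          \<bullet> (x (Suc (Suc n)) - x (Suc n))) \<le> G (x (Suc (Suc n)))"
        using prox_variational_inequality[OF assms(2) \<tau> xd[of "Suc (Suc n)"]]
        unfolding G_def xS[of n] by simp
      show "H (y (Suc n)) + 1 / (\<beta> * \<tau> (Suc n)) * ((y n + (\<beta> * \<tau> (Suc n)) *\<^sub>R K (x (Suc n)) - y (Suc n))
          \<bullet> (yb - y (Suc n))) \<le> H yb"
        unfolding H_def yS[of n] dual_step_def F_def[symmetric]
        using prox_variational_inequality[OF F _ yb] \<tau> assms(10) by simp
      show "z (Suc (Suc n)) = ((\<psi> - 1) / \<psi>) *\<^sub>R x (Suc n) + (1 / \<psi>) *\<^sub>R z (Suc n)"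
        "z (Suc (Suc (Suc n))) = ((\<psi> - 1) / \<psi>) *\<^sub>R x (Suc (Suc n)) + (1 / \<psi>) *\<^sub>R z (Suc (Suc n))"
        by (rule zS)+
      show "\<tau> (Suc n) \<le> (1 + \<psi>) / \<psi>\<^sup>2 * \<tau> n" using growth by (simp add: \<phi>_def)
      show "sqrt (\<beta> * \<tau> (Suc n)) * norm (adjoint K (y (Suc n)) - adjoint K (y n))
          \<le> \<sigma> * sqrt (\<psi> / \<tau> n) * norm (y (Suc n) - y n)" by (rule search)
    qed
    define R where "R = \<psi> / (\<psi> - 1) * (norm (z 2 - xb))\<^sup>2 + 1 / \<beta> * (norm (y 0 - yb))\<^sup>2"
    have R: "R \<ge> 0" using assms(6,10) by (simp add: R_def)
    have tel: "2 * (\<Sum>n=1..M. \<tau> n * gap (x n) (y n))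
        + \<psi> / (\<psi> - 1) * (norm (z (Suc (Suc M)) - xb))\<^sup>2 + 1 / \<beta> * (norm (y M - yb))\<^sup>2 \<le> R" for M
    proof (induction M)
      case 0 show ?case by (simp add: R_def numeral_2_eq_2)
    next
      case (Suc M) then show ?case using step[of M] by (simp add: algebra_simps)
    qed
    have "\<psi> / (\<psi> - 1) * (norm (z (Suc (Suc N)) - xb))\<^sup>2 + 1 / \<beta> * (norm (y N - yb))\<^sup>2 \<ge> 0"
      using assms(6,10) by simp
    then have tel: "2 * (\<Sum>n=1..N. \<tau> n * gap (x n) (y n)) \<le> R" using tel[of N] by linarith
    define S where "S = (\<Sum>n=1..N. \<tau> n)"
    have S: "S > 0" unfolding S_def using \<tau> N by (intro sum_pos) auto
    define X where "X = ergodic_mean \<tau> x N"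
    define Y where "Y = ergodic_mean \<tau> y N"
    have cG: "convex_on (edom g) G" and cH: "convex_on (edom F) H"
      unfolding G_def H_def using closed_proper_convex_convex_on assms(2) F by blast+
    have XY: "X \<in> edom g" "Y \<in> edom F"
      unfolding X_def Y_def
      using ergodic_mean_in_convex[OF cG xd \<tau> N] ergodic_mean_in_convex[OF cH yd \<tau> N] by auto
    have jG: "S * G X \<le> (\<Sum>n=1..N. \<tau> n * G (x n))"
      unfolding S_def X_def by (rule ergodic_mean_convex_on_le[OF cG xd \<tau> N])
    have jH: "S * H Y \<le> (\<Sum>n=1..N. \<tau> n * H (y n))"
      unfolding S_def Y_def by (rule ergodic_mean_convex_on_le[OF cH yd \<tau> N])
    have lK: "S * (K X \<bullet> yb) = (\<Sum>n=1..N. \<tau> n * (K (x n) \<bullet> yb))"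
      using ergodic_mean_linear[OF assms(3), of \<tau> N x yb] S unfolding S_def X_def by simp
    have lI: "S * (K xb \<bullet> Y) = (\<Sum>n=1..N. \<tau> n * (K xb \<bullet> y n))"
      using ergodic_mean_linear[OF linear_id[unfolded id_def], of \<tau> N y "K xb"] S unfolding S_def Y_def
      by (simp add: inner_commute)
    have "(\<Sum>n=1..N. \<tau> n * gap (x n) (y n)) = (\<Sum>n=1..N. \<tau> n * G (x n)) + (\<Sum>n=1..N. \<tau> n * (K (x n) \<bullet> yb))
        - S * H yb - (S * G xb + (\<Sum>n=1..N. \<tau> n * (K xb \<bullet> y n)) - (\<Sum>n=1..N. \<tau> n * H (y n)))"
      by (simp add: gap_def S_def right_diff_distrib distrib_left sum.distrib sum_subtractf sum_distrib_right)
    then have "S * gap X Y \<le> (\<Sum>n=1..N. \<tau> n * gap (x n) (y n))"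
      using jG jH by (simp add: gap_def right_diff_distrib distrib_left lK lI)
    then have "2 * S * gap X Y \<le> R" using tel by linarith
    then have "gap X Y \<le> R / (2 * S)" using S by (simp add: field_simps)
    \<comment> \<open>Since \<open>R \<ge> 0\<close>, replacing \<open>S\<close> by its lower bound
      \<open>c * real N\<close> only enlarges the quotient.\<close>
    also have "\<dots> \<le> R / (2 * (c * real N))"
      using R c N S unfolding S_def by (intro divide_left_mono mult_left_mono mult_pos_pos) auto
    finally have "gap X Y \<le> 1 / (2 * c * real N) * R" by (simp add: mult.assoc)
    then show ?thesis
      using pd_gap_real[OF assms(1,2) XY(1) xb XY(2)[unfolded F_def] yb[unfolded F_def], of K]
      by (simp add: gap_def G_def H_def F_def X_def Y_def R_def)
  qed
  then show ?thesis using c by blast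
qed

end
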